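(* Let $p\ge2$ be an even integer and $r=\frac p2$. For $1\le r\le8$, $$\mathcal{M}^{\mathrm{EM}}_p(\mathcal{S}_p)<\sqrt{\frac2\pi}\cdot\frac{4.74^p}{\sqrt p},$$ while for any $r\ge9$, $$\mathcal{M}^{\mathrm{EM}}_p(\mathcal{S}_p)<\frac{4.986^p}{\pi\sqrt{p-1}}.$$
   Context: Explicit midpoint (EM) extrapolation of even order $p\ge2$, $r=p/2$, on the test equation $U'=\lambda U$, with $z=\tau\lambda\in\mathbb{C}$ and internal perturbations: given $U_n$ and residuals $\tilde r_{m,j}\in\mathbb{C}$ ($1\le m\le r$, $1\le j\le2m$), set $$\widetilde Y_{m,0}=U_n,\quad \widetilde Y_{m,1}=\Big(1+\frac z{2m}\Big)\widetilde Y_{m,0}+\tilde r_{m,1},\quad \widetilde Y_{m,j}=\widetilde Y_{m,j-2}+\frac zm\widetilde Y_{m,j-1}+\tilde r_{m,j}\ (2\le j\le2m),\quad T_{m,1}=\widetilde Y_{m,2m},$$ $$T_{j,k}=T_{j,k-1}+\frac{T_{j,k-1}-T_{j-1,k-1}}{\frac{j^2}{(j-k+1)^2}-1}\quad(2\le k\le j\le r),\qquad U_{n+1}=T_{r,r}.$$ Then $U_{n+1}=P(z)U_n+\sum_{m=1}^r\sum_{\ell=1}^{2m}Q^{\mathrm{EM}}_{p,m,\ell}(z)\,\tilde r_{m,\ell}$, which defines the internal stability polynomials $Q^{\mathrm{EM}}_{p,m,\ell}$. For $\mathcal{S}\subset\mathbb{C}$, $$\mathcal{M}^{\mathrm{EM}}_p(\mathcal{S}):=\max_{1\le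 m\le r}\max_{1\le\ell\le2m}\sup_{z\in\mathcal{S}}|Q^{\mathrm{EM}}_{p,m,\ell}(z)|.$$ The absolute stability region of the method is $\mathcal{S}_p=\{z\in\mathbb{C}:|\sum_{k=0}^pz^k/k!|\le1\}$. *)

theory Defs
  imports "HOL-Computational_Algebra.Polynomial" "HOL-Library.Extended_Real"
begin

text \<open>
  One perturbed step of explicit midpoint extrapolation applied to the test equation
  \<open>U' = \<lambda> U\<close>, with \<open>z = \<tau> \<lambda>\<close>, initial value \<open>U\<close> and residuals \<open>\<rho> m j\<close>.
\<close>

fun em_stage :: "complex \<Rightarrow> complex \<Rightarrow> (nat \<Rightarrow> nat \<Rightarrow> complex) \<Rightarrow> nat \<Rightarrow> nat \<Rightarrow> complex" where
  "em_stage z U \<rho> m 0 = U"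
| "em_stage z U \<rho> m (Suc 0) = (1 + z / (2 * of_nat m)) * em_stage z U \<rho> m 0 + \<rho> m 1"
| "em_stage z U \<rho> m (Suc (Suc j)) =
     em_stage z U \<rho> m j + z / of_nat m * em_stage z U \<rho> m (Suc j) + \<rho> m (Suc (Suc j))"

text \<open>
  Extrapolation tableau \<open>T\<^sub>j\<^sub>,\<^sub>k\<close>; it is only meaningful for \<open>1 \<le> k \<le> j\<close>, and column \<open>0\<close> is a
  filler.  In column \<open>Suc (Suc k)\<close> the difference \<open>j - Suc k\<close> is the \<open>j - k + 1\<close> of the
  usual notation.
\<close>

fun em_tableau :: "complex \<Rightarrow> complex \<Rightarrow> (nat \<Rightarrow> nat \<Rightarrow> complex) \<Rightarrow> nat \<Rightarrow> nat \<Rightarrow> complex" where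
  "em_tableau z U \<rho> j 0 = 0"
| "em_tableau z U \<rho> j (Suc 0) = em_stage z U \<rho> j (2 * j)"
| "em_tableau z U \<rho> j (Suc (Suc k)) =
     em_tableau z U \<rho> j (Suc k) +
     (em_tableau z U \<rho> j (Suc k) - em_tableau z U \<rho> (j - 1) (Suc k)) /
       ((of_nat j)\<^sup>2 / (of_nat (j - Suc k))\<^sup>2 - 1)"

definition em_step :: "nat \<Rightarrow> complex \<Rightarrow> complex \<Rightarrow> (nat \<Rightarrow> nat \<Rightarrow> complex) \<Rightarrow> complex" where
  "em_step p z U \<rho> = em_tableau z U \<rho> (p div 2) (p div 2)"

definition em_expansion :: "nat \<Rightarrow> complex poly \<Rightarrow> (nat \<Rightarrow> nat \<Rightarrow> complex poly) \<Rightarrow> bool" where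
  "em_expansion p P Q \<longleftrightarrow>
     (\<forall>z U \<rho>. em_step p z U \<rho> =
        poly P z * U + (\<Sum>m=1..p div 2. \<Sum>l=1..2*m. poly (Q m l) z * \<rho> m l))"

text \<open>
  The internal stability polynomial \<open>Q\<^sub>p\<^sub>,\<^sub>m\<^sub>,\<^sub>l\<close>; the description is well defined for
  \<open>1 \<le> m \<le> p div 2\<close>, \<open>1 \<le> l \<le> 2 * m\<close> by the lemmas
  \<open>em_expansion_exists\<close> and \<open>em_expansion_unique\<close> below.
\<close>

definition em_Q :: "nat \<Rightarrow> nat \<Rightarrow> nat \<Rightarrow> complex poly" where
  "em_Q p m l = (THE q. \<exists>P Q. em_expansion p P Q \<and> q = Q m l)"

text \<open>
  The supremum is taken in the extended reals, so that an upper bound on it entails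
  boundedness of the polynomials on \<open>S\<close>.
\<close>

definition em_M :: "nat \<Rightarrow> complex set \<Rightarrow> ereal" where
  "em_M p S = (MAX m\<in>{1..p div 2}. MAX l\<in>{1..2*m}. SUP z\<in>S. ereal (cmod (poly (em_Q p m l) z)))"

definition stab_region :: "nat \<Rightarrow> complex set" where
  "stab_region p = {z. cmod (\<Sum>k=0..p. z ^ k / fact k) \<le> 1}"

definition has_expansion ::
  "nat \<Rightarrow> (complex \<Rightarrow> complex \<Rightarrow> (nat \<Rightarrow> nat \<Rightarrow> complex) \<Rightarrow> complex) \<Rightarrow> bool" where
  "has_expansion r F \<longleftrightarrow>
     (\<exists>P Q. \<forall>z U \<rho>. F z U \<rho> = poly P z * U + (\<Sum>m=1..r. \<Sum>l=1..2*m. poly (Q m l) z * \<rho> m l))"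

lemma has_expansion_U: "has_expansion r (\<lambda>z U \<rho>. U)"
  unfolding has_expansion_def
  by (rule exI[of _ 1], rule exI[of _ "\<lambda>_ _. 0"]) simp

lemma double_sum_delta:
  fixes f :: "nat \<Rightarrow> nat \<Rightarrow> complex"
  assumes "m \<in> {1..r}" "l \<in> {1..2*m}"
  shows "(\<Sum>i=1..r. \<Sum>k=1..2*i. if i = m \<and> k = l then f i k else 0) = f m l"
proof -
  have "(\<Sum>k=1..2*i. if i = m \<and> k = l then f i k else 0) = (if i = m then f m l else 0)" for i
    using assms by (cases "i = m") (simp_all add: sum.delta)
  then show ?thesis
    using assms by (simp add: sum.delta)
qed

lemma has_expansion_residual:
  assumes "m \<in> {1..r}" "l \<in> {1..2*m}"
  shows "has_expansion r (\<lambda>z U \<rho>. \<rho> m l)"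
proof -
  have "\<rho> m l = poly 0 z * U +
      (\<Sum>i=1..r. \<Sum>k=1..2*i. poly (if i = m \<and> k = l then 1 else 0) z * \<rho> i k)"
    for z U :: complex and \<rho> :: "nat \<Rightarrow> nat \<Rightarrow> complex"
  proof -
    have "(\<Sum>i=1..r. \<Sum>k=1..2*i. poly (if i = m \<and> k = l then 1 else 0) z * \<rho> i k) =
        (\<Sum>i=1..r. \<Sum>k=1..2*i. if i = m \<and> k = l then \<rho> i k else 0)"
      by (intro sum.cong refl) simp
    then show ?thesis
      using double_sum_delta[OF assms, of \<rho>] by simp
  qed
  then show ?thesis
    unfolding has_expansion_def
    by (intro exI[of _ 0] exI[of _ "\<lambda>i k. if i = m \<and> k = l then 1 else 0"] allI)
qed

lemma has_expansion_add:
  assumes "has_expansion r F" "has_expansion r G"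
  shows "has_expansion r (\<lambda>z U \<rho>. F z U \<rho> + G z U \<rho>)"
proof -
  obtain P Q where F: "\<And>z U \<rho>. F z U \<rho> =
      poly P z * U + (\<Sum>m=1..r. \<Sum>l=1..2*m. poly (Q m l) z * \<rho> m l)"
    using assms(1) unfolding has_expansion_def by blast
  obtain P' Q' where G: "\<And>z U \<rho>. G z U \<rho> =
      poly P' z * U + (\<Sum>m=1..r. \<Sum>l=1..2*m. poly (Q' m l) z * \<rho> m l)"
    using assms(2) unfolding has_expansion_def by blast
  show ?thesis
    unfolding has_expansion_def F G
    by (rule exI[of _ "P + P'"], rule exI[of _ "\<lambda>m l. Q m l + Q' m l"])
       (simp add: sum.distrib algebra_simps)
qed

lemma has_expansion_mult:
  assumes "has_expansion r F"
  shows "has_expansion r (\<lambda>z U \<rho>. poly c z * F z U \<rho>)"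
proof -
  obtain P Q where F: "\<And>z U \<rho>. F z U \<rho> =
      poly P z * U + (\<Sum>m=1..r. \<Sum>l=1..2*m. poly (Q m l) z * \<rho> m l)"
    using assms(1) unfolding has_expansion_def by blast
  show ?thesis
    unfolding has_expansion_def F
    by (rule exI[of _ "c * P"], rule exI[of _ "\<lambda>m l. c * Q m l"])
       (simp add: sum_distrib_left algebra_simps)
qed

lemma has_expansion_stage:
  assumes "j \<le> 2 * m" "m \<le> r"
  shows "has_expansion r (\<lambda>z U \<rho>. em_stage z U \<rho> m j)"
  using assms
proof (induction j rule: induct_nat_012)
  case 0
  then show ?case by (simp add: has_expansion_U)
next
  case 1
  have "has_expansion r (\<lambda>z U \<rho>. poly [:1, 1 / (2 * of_nat m):] z * U + \<rho> m 1)"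
    using 1 by (intro has_expansion_add has_expansion_mult has_expansion_U has_expansion_residual) auto
  then show ?case by simp
next
  case (ge2 j)
  have "has_expansion r (\<lambda>z U \<rho>. em_stage z U \<rho> m j +
      poly [:0, 1 / of_nat m:] z * em_stage z U \<rho> m (Suc j) + \<rho> m (Suc (Suc j)))"
    using ge2 by (intro has_expansion_add has_expansion_mult has_expansion_residual) auto
  then show ?case by simp
qed

lemma has_expansion_tableau:
  assumes "j \<le> r"
  shows "has_expansion r (\<lambda>z U \<rho>. em_tableau z U \<rho> j k)"
  using assms
proof (induction k arbitrary: j rule: induct_nat_012)
  case 0
  then show ?case using has_expansion_mult[OF has_expansion_U, of r 0] by simp
next
  case 1
  then show ?case by (simp add: has_expansion_stage)
next
  case (ge2 k)
  define c :: complex where "c = 1 / ((of_nat j)\<^sup>2 / (of_nat (j - Suc k))\<^sup>2 - 1)"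
  have "has_expansion r (\<lambda>z U \<rho>. poly [:1 + c:] z * em_tableau z U \<rho> j (Suc k) +
      poly [:- c:] z * em_tableau z U \<rho> (j - 1) (Suc k))"
    using ge2 by (intro has_expansion_add has_expansion_mult) auto
  moreover have "em_tableau z U \<rho> j (Suc (Suc k)) =
      poly [:1 + c:] z * em_tableau z U \<rho> j (Suc k) +
      poly [:- c:] z * em_tableau z U \<rho> (j - 1) (Suc k)" for z U \<rho>
  proof -
    have "em_tableau z U \<rho> j (Suc (Suc k)) = em_tableau z U \<rho> j (Suc k) +
        (em_tableau z U \<rho> j (Suc k) - em_tableau z U \<rho> (j - 1) (Suc k)) * c"
      by (simp add: c_def)
    then show ?thesis by (simp add: algebra_simps)
  qed
  ultimately show ?case by presburger
qed

lemma em_expansion_exists: "\<exists>P Q. em_expansion p P Q"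
  using has_expansion_tableau[of "p div 2" "p div 2" "p div 2"]
  by (simp add: has_expansion_def em_expansion_def em_step_def)

lemma em_expansion_unique:
  assumes "em_expansion p P Q" "em_expansion p P' Q'" "m \<in> {1..p div 2}" "l \<in> {1..2*m}"
  shows "Q m l = Q' m l"
proof -
  have unit: "em_step p z 0 (\<lambda>i k. if i = m \<and> k = l then 1 else 0) = poly (Q m l) z"
    if "em_expansion p P Q" for P Q z
  proof -
    have "em_step p z 0 (\<lambda>i k. if i = m \<and> k = l then 1 else 0) =
        (\<Sum>i=1..p div 2. \<Sum>k=1..2*i. poly (Q i k) z * (if i = m \<and> k = l then 1 else 0))"
      using that by (simp add: em_expansion_def)
    also have "\<dots> = (\<Sum>i=1..p div 2. \<Sum>k=1..2*i. if i = m \<and> k = l then poly (Q i k) z else 0)"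
      by (intro sum.cong refl) simp
    also have "\<dots> = poly (Q m l) z"
      using double_sum_delta[OF assms(3,4), of "\<lambda>i k. poly (Q i k) z"] .
    finally show ?thesis .
  qed
  have "poly (Q m l) = poly (Q' m l)"
    using unit[OF assms(1)] unit[OF assms(2)] by (metis ext)
  then show ?thesis
    by (simp add: poly_eq_poly_eq_iff)
qed

lemma em_Q_eq:
  assumes "em_expansion p P Q" "m \<in> {1..p div 2}" "l \<in> {1..2*m}"
  shows "em_Q p m l = Q m l"
  unfolding em_Q_def
  using em_expansion_unique[OF _ assms(1) assms(2,3)] assms(1) by (intro the_equality) blast+

end

theory Submission
  imports Defs "HOL-Analysis.Complex_Transcendental"
begin

text \<open>
  A residual injected at stage \<open>l\<close> of the \<open>m\<close>-th midpoint sequence is propagated by the homogeneous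
  recurrence \<open>y\<^sub>k\<^sub>+\<^sub>2 = y\<^sub>k + (z/m) y\<^sub>k\<^sub>+\<^sub>1\<close>, whose solution is a Fibonacci polynomial \<open>F\<close>, and the
  extrapolation then multiplies the result by the Lagrange weight \<open>c\<^sub>m\<close> of the node \<open>1/m\<^sup>2\<close> at the
  origin.  So \<open>Q\<^sub>p\<^sub>,\<^sub>m\<^sub>,\<^sub>l(z) = c\<^sub>m F(z/m)\<close> with index \<open>2m - l\<close> (\<open>poly_em_Q\<close>), and with \<open>r = p/2\<close> one has
  \<open>\<bar>c\<^sub>m\<bar> = 2 m\<^bsup>2r\<^esup> / ((r-m)! (r+m)!)\<close> (\<open>cmod_extrap_weight\<close>).

  The stability region is contained in the disk \<open>\<bar>z\<bar> \<le> 4p/3\<close> (\<open>stab_region_subset_cball\<close>).  This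
  follows from the argument behind the Enestroem-Kakeya theorem: the coefficients \<open>p\<^sup>k/k!\<close> of the
  truncated exponential in the variable \<open>w = z/p\<close> increase up to \<open>k = p\<close>, so outside the unit disk the
  polynomial is at least \<open>(\<bar>w\<bar>-1)/(\<bar>w\<bar>+1)\<close> times its value at \<open>\<bar>w\<bar>\<close>.

  The radius \<open>4p/3\<close> is convenient because \<open>8/3 = 3 - 1/3\<close>: the Fibonacci recurrence with argument
  \<open>8r/(3m)\<close> grows no faster than the powers of \<open>3r/m\<close>.  Hence
  \<open>\<bar>Q\<bar> \<le> 2 m\<^bsup>2r\<^esup> (3r/m)\<^bsup>2m-1\<^esup> / ((r-m)! (r+m)!) \<le> (2/3) r\<^bsup>2r\<^esup> 9\<^sup>m / ((r-m)! (r+m)!)\<close>, and since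
  \<open>9\<^sup>m = 3\<^bsup>r+m\<^esup> (1/3)\<^bsup>r-m\<^esup>\<close>, up to the factor \<open>(2r)!\<close> the last quotient is a single term of the binomial
  expansion of \<open>(3 + 1/3)\<^bsup>2r\<^esup>\<close>.  The outcome is the bound \<open>(2/3) (5/3)\<^sup>p p\<^sup>p/p!\<close>, uniform in \<open>m\<close> and \<open>l\<close>
  (\<open>cmod_em_Q_le\<close>).  By \<open>p\<^sup>p/p! \<le> e\<^sup>p/2\<close> it grows at most like \<open>(5e/3)\<^sup>p\<close>, and \<open>5e/3\<close> is about \<open>4.53\<close>,
  which leaves room below \<open>4.74\<close> for the factor \<open>\<surd>p\<close>.

  For \<open>p \<ge> 18\<close> the bound with base \<open>4.986\<close> follows from the one with base \<open>4.74\<close>: from there on, the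
  larger base has made up for the smaller constant factor (\<open>bound_474_less_bound_4986\<close>).
\<close>

section \<open>Extrapolation weights\<close>

text \<open>
  The value at \<open>0\<close> of the Lagrange basis polynomial of the node \<open>1/i\<^sup>2\<close> among the nodes \<open>1/h\<^sup>2\<close>,
  \<open>h \<in> A\<close>, with denominators cleared.
\<close>

definition extrap_weight :: "nat set \<Rightarrow> nat \<Rightarrow> complex" where
  "extrap_weight A i = (\<Prod>h\<in>A - {i}. (of_nat i)\<^sup>2 / ((of_nat i)\<^sup>2 - (of_nat h)\<^sup>2))"

lemma of_nat_square_eq_iff:
  "(of_nat m)\<^sup>2 = (of_nat n :: complex)\<^sup>2 \<longleftrightarrow> m = n"
proof -
  have "(of_nat m)\<^sup>2 = (of_nat n :: complex)\<^sup>2 \<longleftrightarrow> m\<^sup>2 = n\<^sup>2"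
    by (metis of_nat_eq_iff of_nat_power)
  then show ?thesis by simp
qed

lemma extrap_weight_insert:
  assumes "finite A" "h \<notin> A" "h \<noteq> i"
  shows "extrap_weight (insert h A) i =
    (of_nat i)\<^sup>2 / ((of_nat i)\<^sup>2 - (of_nat h)\<^sup>2) * extrap_weight A i"
proof -
  have "insert h A - {i} = insert h (A - {i})" using assms by auto
  then show ?thesis using assms by (simp add: extrap_weight_def)
qed

lemma extrap_weight_insert_same: "extrap_weight (insert i A) i = extrap_weight A i"
  by (simp add: extrap_weight_def)

text \<open>
  This is the Aitken-Neville step: with \<open>A = a\<^sup>2\<close> and \<open>B = b\<^sup>2\<close>, a step of the tableau is the affine combination
  \<open>B/(B-A) hi - A/(B-A) lo\<close>.  For a node \<open>i\<close> strictly between \<open>a\<close> and \<open>b\<close> and \<open>X = i\<^sup>2\<close>, the two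
  weights differ from that of \<open>{a<..<b}\<close> by the factors \<open>X/(X-B)\<close> and \<open>X/(X-A)\<close>, and the combination of
  these factors is their product.  The two extreme nodes occur in only one of the two sums.
\<close>

lemma extrap_weight_merge:
  fixes t :: "nat \<Rightarrow> complex"
  assumes "1 \<le> a" "a < b"
  defines "hi \<equiv> \<Sum>i\<in>{Suc a..b}. extrap_weight {Suc a..b} i * t i"
    and "lo \<equiv> \<Sum>i\<in>{a..b - 1}. extrap_weight {a..b - 1} i * t i"
  shows "hi + (hi - lo) / ((of_nat b)\<^sup>2 / (of_nat a)\<^sup>2 - 1) =
    (\<Sum>i\<in>{a..b}. extrap_weight {a..b} i * t i)"
proof -
  define M where "M = {Suc a..<b}"
  have fin: "finite M" and notin: "a \<notin> M" "b \<notin> M" "a \<noteq> b"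
    using assms by (auto simp: M_def)
  have sets: "{Suc a..b} = insert b M" "{a..b - 1} = insert a M" "{a..b} = insert a (insert b M)"
    using assms(1,2) by (auto simp: M_def)
  define A B :: complex where "A = (of_nat a)\<^sup>2" and "B = (of_nat b)\<^sup>2"
  have AB: "A \<noteq> 0" "A \<noteq> B" "B - A \<noteq> 0" "A - B \<noteq> 0"
    using assms(1,2) of_nat_square_eq_iff[of a b] by (auto simp: A_def B_def)
  have combine: "x + (x - y) / (B / A - 1) = B / (B - A) * x - A / (B - A) * y" for x y
  proof -
    define C where "C = B - A"
    have B: "B = A + C" and "C \<noteq> 0" using AB by (simp_all add: C_def)
    have "(A + C) / A - 1 = C / A" using AB by (simp add: add_divide_distrib)
    then show ?thesis unfolding B using AB \<open>C \<noteq> 0\<close> by (simp add: field_simps)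
  qed
  have inner: "B / (B - A) * (extrap_weight (insert b M) i * t i)
      - A / (B - A) * (extrap_weight (insert a M) i * t i)
      = extrap_weight (insert a (insert b M)) i * t i" if "i \<in> M" for i
  proof -
    define X :: complex where "X = (of_nat i)\<^sup>2"
    have "i \<noteq> a" "i \<noteq> b" using that notin by auto
    then have X: "X - A \<noteq> 0" "X - B \<noteq> 0"
      using of_nat_square_eq_iff[of i a] of_nat_square_eq_iff[of i b] by (auto simp: X_def A_def B_def)
    have "B / (B - A) * (X / (X - B)) - A / (B - A) * (X / (X - A)) = X / (X - A) * (X / (X - B))"
      using AB X by (simp add: divide_simps) algebra
    then have "(B / (B - A) * (X / (X - B)) - A / (B - A) * (X / (X - A))) * (extrap_weight M i * t i)
        = X / (X - A) * (X / (X - B)) * (extrap_weight M i * t i)"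
      by simp
    moreover have "extrap_weight (insert b M) i = X / (X - B) * extrap_weight M i"
      "extrap_weight (insert a M) i = X / (X - A) * extrap_weight M i"
      "extrap_weight (insert a (insert b M)) i = X / (X - A) * (X / (X - B) * extrap_weight M i)"
      using fin notin \<open>i \<noteq> a\<close> \<open>i \<noteq> b\<close> by (simp_all add: extrap_weight_insert X_def A_def B_def)
    ultimately show ?thesis by (simp add: algebra_simps)
  qed
  have ends:
    "extrap_weight (insert a (insert b M)) b = B / (B - A) * extrap_weight (insert b M) b"
    "extrap_weight (insert a (insert b M)) a = - (A / (B - A)) * extrap_weight (insert a M) a"
  proof -
    show "extrap_weight (insert a (insert b M)) b = B / (B - A) * extrap_weight (insert b M) b"
      using fin notin by (simp add: extrap_weight_insert A_def B_def)
    have "extrap_weight (insert a (insert b M)) a = A / (A - B) * extrap_weight (insert a M) a"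
      using fin notin by (simp add: extrap_weight_insert extrap_weight_insert_same A_def B_def)
    moreover have "A / (A - B) = - (A / (B - A))"
      by (metis minus_diff_eq minus_divide_right)
    ultimately show "extrap_weight (insert a (insert b M)) a
        = - (A / (B - A)) * extrap_weight (insert a M) a" by simp
  qed
  have "hi + (hi - lo) / (B / A - 1) = B / (B - A) * hi - A / (B - A) * lo"
    by (rule combine)
  also have "\<dots> = B / (B - A) * (extrap_weight (insert b M) b * t b)
      - A / (B - A) * (extrap_weight (insert a M) a * t a)
      + (\<Sum>i\<in>M. B / (B - A) * (extrap_weight (insert b M) i * t i)
          - A / (B - A) * (extrap_weight (insert a M) i * t i))"
    using fin notin
    unfolding hi_def lo_def sets by (simp add: sum_subtractf sum_distrib_left ring_distribs)
  also have "(\<Sum>i\<in>M. B / (B - A) * (extrap_weight (insert b M) i * t i)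
          - A / (B - A) * (extrap_weight (insert a M) i * t i))
      = (\<Sum>i\<in>M. extrap_weight (insert a (insert b M)) i * t i)"
    by (intro sum.cong refl inner)
  also have "B / (B - A) * (extrap_weight (insert b M) b * t b)
      - A / (B - A) * (extrap_weight (insert a M) a * t a) + \<dots>
      = (\<Sum>i\<in>{a..b}. extrap_weight {a..b} i * t i)"
    using fin notin by (simp add: sets ends mult.assoc)
  finally show ?thesis by (simp add: A_def B_def)
qed

lemma em_tableau_eq_weighted_sum:
  assumes "1 \<le> k" "k \<le> j"
  shows "em_tableau z U \<rho> j k =
    (\<Sum>i\<in>{Suc (j - k)..j}. extrap_weight {Suc (j - k)..j} i * em_stage z U \<rho> i (2 * i))"
  using assms
proof (induction k arbitrary: j rule: nat_induct_at_least)
  case base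
  then have "{Suc (j - 1)..j} = {j}" by auto
  then show ?case by (simp add: extrap_weight_def)
next
  case (Suc k)
  obtain k' where k: "k = Suc k'" using Suc.hyps by (cases k) auto
  have "em_tableau z U \<rho> j (Suc k) = em_tableau z U \<rho> j k +
     (em_tableau z U \<rho> j k - em_tableau z U \<rho> (j - 1) k) /
       ((of_nat j)\<^sup>2 / (of_nat (j - k))\<^sup>2 - 1)"
    by (simp add: k)
  moreover have "Suc (j - 1 - k) = j - k" "Suc (j - Suc k) = j - k"
    using Suc.prems by simp_all
  ultimately show ?case
    using extrap_weight_merge[of "j - k" j] Suc by simp
qed

text \<open>
  Since \<open>m\<^sup>2 - h\<^sup>2 = (m-h)(m+h)\<close>, the product together with the middle factor \<open>m\<close> runs through the
  consecutive integers from \<open>m-n\<close> to \<open>m+n\<close>.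
\<close>

lemma prod_square_diff_below:
  assumes "n < m"
  shows "(\<Prod>h=1..n. \<bar>(real m)\<^sup>2 - (real h)\<^sup>2\<bar>) * real m * fact (m - Suc n) = fact (m + n)"
  using assms
proof (induction n)
  case 0
  then show ?case by (cases m) simp_all
next
  case (Suc n)
  have "\<bar>(real m)\<^sup>2 - (real (Suc n))\<^sup>2\<bar> = (real m)\<^sup>2 - (real (Suc n))\<^sup>2"
    using Suc.prems by (simp add: power_mono)
  also have "\<dots> = real (m - Suc n) * real (m + Suc n)"
    using Suc.prems by (simp add: of_nat_diff power2_eq_square algebra_simps)
  finally have step: "\<bar>(real m)\<^sup>2 - (real (Suc n))\<^sup>2\<bar> = real (m - Suc n) * real (m + Suc n)" .
  have "m - Suc n = Suc (m - Suc (Suc n))" using Suc.prems by simp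
  then have f: "(fact (m - Suc n) :: real) = real (m - Suc n) * fact (m - Suc (Suc n))"
    by (metis fact_Suc)
  have "(\<Prod>h=1..Suc n. \<bar>(real m)\<^sup>2 - (real h)\<^sup>2\<bar>) * real m * fact (m - Suc (Suc n))
      = real (m + Suc n) * ((\<Prod>h=1..n. \<bar>(real m)\<^sup>2 - (real h)\<^sup>2\<bar>) * real m * fact (m - Suc n))"
    by (simp only: prod.cl_ivl_Suc step f) simp
  also have "\<dots> = fact (m + Suc n)"
    using Suc by simp
  finally show ?case .
qed

text \<open>
  The factors with \<open>h < m\<close> give the case \<open>r = m\<close>; each later one, \<open>h\<^sup>2 - m\<^sup>2 = (h-m)(h+m)\<close>, extends both
  factorials by one step.
\<close>

lemma prod_square_diff:
  assumes "1 \<le> m" "m \<le> r"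
  shows "(\<Prod>h\<in>{1..r} - {m}. \<bar>(real m)\<^sup>2 - (real h)\<^sup>2\<bar>) * (2 * (real m)\<^sup>2)
    = fact (r - m) * fact (r + m)"
  using assms(2)
proof (induction r rule: dec_induct)
  case base
  have "{1..m} - {m} = {1..m - 1}" using assms by auto
  moreover have "(\<Prod>h=1..m - 1. \<bar>(real m)\<^sup>2 - (real h)\<^sup>2\<bar>) * real m = fact (2 * m - 1)"
    using prod_square_diff_below[of "m - 1" m] assms by (simp add: mult_2)
  moreover have "(fact (m + m) :: real) = 2 * real m * fact (2 * m - 1)"
  proof -
    have "m + m = Suc (2 * m - 1)" using assms by simp
    then have "(fact (m + m) :: real) = real (m + m) * fact (2 * m - 1)"
      by (metis fact_Suc)
    then show ?thesis by simp
  qed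
  ultimately show ?case by (simp add: power2_eq_square)
next
  case (step r)
  have "{1..Suc r} - {m} = insert (Suc r) ({1..r} - {m})" using step by auto
  then have "(\<Prod>h\<in>{1..Suc r} - {m}. \<bar>(real m)\<^sup>2 - (real h)\<^sup>2\<bar>) * (2 * (real m)\<^sup>2)
    = \<bar>(real m)\<^sup>2 - (real (Suc r))\<^sup>2\<bar> * (fact (r - m) * fact (r + m))"
    using step.IH by simp
  also have "\<bar>(real m)\<^sup>2 - (real (Suc r))\<^sup>2\<bar> = (real (Suc r))\<^sup>2 - (real m)\<^sup>2"
    using step by (simp add: power_mono)
  also have "\<dots> = real (Suc r - m) * real (Suc r + m)"
    using step by (simp add: of_nat_diff power2_eq_square algebra_simps)
  also have "\<dots> * (fact (r - m) * fact (r + m)) = fact (Suc r - m) * fact (Suc r + m)"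
    using step by (simp add: Suc_diff_le)
  finally show ?case .
qed

lemma cmod_extrap_weight:
  assumes "1 \<le> m" "m \<le> r"
  shows "cmod (extrap_weight {1..r} m) = 2 * real m ^ (2 * r) / (fact (r - m) * fact (r + m))"
proof -
  have D: "cmod ((of_nat m)\<^sup>2 - (of_nat h)\<^sup>2) = \<bar>(real m)\<^sup>2 - (real h)\<^sup>2\<bar>" for h
  proof -
    have "(of_nat m)\<^sup>2 - (of_nat h)\<^sup>2 = complex_of_real ((real m)\<^sup>2 - (real h)\<^sup>2)" by simp
    then show ?thesis by (metis norm_of_real)
  qed
  have card: "card ({1..r} - {m}) = r - 1" using assms by simp
  have "cmod (extrap_weight {1..r} m)
      = (\<Prod>h\<in>{1..r} - {m}. (real m)\<^sup>2 / \<bar>(real m)\<^sup>2 - (real h)\<^sup>2\<bar>)"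
    by (simp add: extrap_weight_def prod_norm[symmetric] norm_divide norm_power D)
  also have "\<dots> = (real m)\<^sup>2 ^ (r - 1) / (\<Prod>h\<in>{1..r} - {m}. \<bar>(real m)\<^sup>2 - (real h)\<^sup>2\<bar>)"
    by (simp only: prod_dividef prod_constant card)
  also have "\<dots> = 2 * ((real m)\<^sup>2 ^ (r - 1) * (real m)\<^sup>2) /
      ((\<Prod>h\<in>{1..r} - {m}. \<bar>(real m)\<^sup>2 - (real h)\<^sup>2\<bar>) * (2 * (real m)\<^sup>2))"
    using assms by simp
  also have "(real m)\<^sup>2 ^ (r - 1) * (real m)\<^sup>2 = real m ^ (2 * r)"
    using assms by (metis power_minus_mult power_mult less_le_trans zero_less_one)
  finally show ?thesis
    by (simp only: prod_square_diff[OF assms])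
qed

section \<open>Propagation of one residual\<close>

text \<open>The Fibonacci polynomial usually written \<open>F\<^sub>k\<^sub>+\<^sub>1\<close>.\<close>

fun midpoint_response :: "'a::comm_ring_1 \<Rightarrow> nat \<Rightarrow> 'a" where
  "midpoint_response x 0 = 1"
| "midpoint_response x (Suc 0) = x"
| "midpoint_response x (Suc (Suc k)) = midpoint_response x k + x * midpoint_response x (Suc k)"

lemma em_stage_unit_residual:
  assumes "1 \<le> l"
  shows "em_stage z 0 (\<lambda>i k. if i = m \<and> k = l then 1 else 0) i j =
    (if i = m \<and> l \<le> j then midpoint_response (z / of_nat m) (j - l) else 0)"
proof (induction j rule: induct_nat_012)
  case 0
  then show ?case using assms by simp
next
  case 1
  then show ?case using assms by auto
next
  case (ge2 j)
  consider "l \<le> j" | "l = Suc j" | "l = Suc (Suc j)" | "l > Suc (Suc j)" by linarith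
  then show ?case
  proof cases
    case 1
    then have "Suc (Suc j) - l = Suc (Suc (j - l))" "Suc j - l = Suc (j - l)" by simp_all
    then show ?thesis using 1 ge2 by simp
  qed (use ge2 in auto)
qed

text \<open>
  By linearity, the coefficient of \<open>\<rho> m l\<close> is the output of a step whose only input is a unit residual
  in that position; then only the \<open>m\<close>-th sequence is nonzero.
\<close>

lemma poly_em_Q:
  assumes "m \<in> {1..p div 2}" "l \<in> {1..2 * m}"
  shows "poly (em_Q p m l) z =
    extrap_weight {1..p div 2} m * midpoint_response (z / of_nat m) (2 * m - l)"
proof -
  define \<delta> :: "nat \<Rightarrow> nat \<Rightarrow> complex" where "\<delta> = (\<lambda>i k. if i = m \<and> k = l then 1 else 0)"
  obtain P Q where PQ: "em_expansion p P Q" using em_expansion_exists by blast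
  have "em_step p z 0 \<delta> = (\<Sum>i=1..p div 2. \<Sum>k=1..2*i. if i = m \<and> k = l then poly (Q i k) z else 0)"
    using PQ unfolding em_expansion_def \<delta>_def by (auto intro!: sum.cong)
  also have "\<dots> = poly (em_Q p m l) z"
    using double_sum_delta[OF assms, of "\<lambda>i k. poly (Q i k) z"] em_Q_eq[OF PQ assms] by simp
  finally have "poly (em_Q p m l) z = em_step p z 0 \<delta>" ..
  also have "\<dots> = (\<Sum>i\<in>{1..p div 2}. extrap_weight {1..p div 2} i * em_stage z 0 \<delta> i (2 * i))"
    using em_tableau_eq_weighted_sum[of "p div 2" "p div 2" z 0 \<delta>] assms
    by (simp add: em_step_def)
  also have "\<dots> = (\<Sum>i\<in>{1..p div 2}. if i = m
      then extrap_weight {1..p div 2} m * midpoint_response (z / of_nat m) (2 * m - l) else 0)"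
    using assms by (intro sum.cong) (auto simp: \<delta>_def em_stage_unit_residual)
  also have "\<dots> = extrap_weight {1..p div 2} m * midpoint_response (z / of_nat m) (2 * m - l)"
    using assms by simp
  finally show ?thesis .
qed

text \<open>
  The hypothesis makes the powers of \<open>a\<close> a supersolution of the recurrence with \<open>norm x\<close> in place
  of \<open>x\<close>; for \<open>a > 0\<close> it says \<open>norm x \<le> a - 1/a\<close>.
\<close>

lemma norm_midpoint_response_le:
  fixes x :: "'a::{real_normed_algebra_1, comm_ring_1}"
  assumes "0 \<le> a" "1 + norm x * a \<le> a\<^sup>2"
  shows "norm (midpoint_response x k) \<le> a ^ k"
proof (induction k rule: induct_nat_012)
  case 0
  then show ?case by simp
next
  case 1
  have "norm x * a \<le> a * a" "a \<noteq> 0" using assms by (auto simp: power2_eq_square)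
  then show ?case using assms(1) by simp
next
  case (ge2 k)
  have "norm (midpoint_response x (Suc (Suc k)))
      \<le> norm (midpoint_response x k) + norm x * norm (midpoint_response x (Suc k))"
    by (simp add: norm_triangle_le norm_mult_ineq)
  also have "\<dots> \<le> a ^ k + norm x * a ^ Suc k"
    using ge2 by (intro add_mono mult_left_mono) auto
  also have "\<dots> = a ^ k * (1 + norm x * a)" by (simp add: algebra_simps)
  also have "\<dots> \<le> a ^ k * a\<^sup>2" using assms by (intro mult_left_mono) auto
  finally show ?case by (simp add: power2_eq_square ac_simps)
qed

section \<open>The stability region lies in a disk\<close>

text \<open>Abel summation, as in the proof of the Enestroem-Kakeya theorem.\<close>

lemma sum_mono_coeff_telescope:
  fixes w :: "'a::comm_ring_1"
  shows "(w - 1) * (\<Sum>k=0..n. a k * w ^ k) + (a 0 + (\<Sum>k=1..n. (a k - a (k - 1)) * w ^ k))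
    = a n * w ^ Suc n"
proof (induction n)
  case 0
  then show ?case by (simp add: algebra_simps)
next
  case (Suc n)
  then show ?case by (simp add: algebra_simps)
qed

text \<open>
  In the identity above, the subtracted sum has nonnegative coefficients, so its norm at \<open>w\<close> is
  at most its value at \<open>norm w\<close>; using the identity once more at \<open>norm w\<close> turns the
  difference back into a multiple of the polynomial.
\<close>

lemma norm_poly_mono_coeff_ge:
  fixes w :: complex and a :: "nat \<Rightarrow> real"
  assumes "0 \<le> a 0" and "\<And>k. k < n \<Longrightarrow> a k \<le> a (Suc k)"
  shows "(norm w - 1) * (\<Sum>k=0..n. a k * norm w ^ k)
    \<le> norm (w - 1) * norm (\<Sum>k=0..n. of_real (a k) * w ^ k)"
proof -
  have inc: "0 \<le> a k - a (k - 1)" if "k \<in> {1..n}" for k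
    using assms(2)[of "k - 1"] that by auto
  have an: "0 \<le> a n"
  proof -
    have "0 \<le> a k" if "k \<le> n" for k
      using that by (induction k) (auto intro: assms order_trans[OF _ assms(2)])
    then show ?thesis by simp
  qed
  let ?d = "of_real (a 0) + (\<Sum>k=1..n. (of_real (a k) - of_real (a (k - 1))) * w ^ k)"
  have "norm (\<Sum>k=1..n. (of_real (a k) - of_real (a (k - 1))) * w ^ k)
      \<le> (\<Sum>k=1..n. (a k - a (k - 1)) * norm w ^ k)"
    using inc by (intro sum_norm_le)
      (simp add: norm_mult norm_power flip: of_real_diff)
  then have d: "norm ?d \<le> a 0 + (\<Sum>k=1..n. (a k - a (k - 1)) * norm w ^ k)"
    using assms(1) by (intro norm_triangle_le) simp
  have "(norm w - 1) * (\<Sum>k=0..n. a k * norm w ^ k)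
      = a n * norm w ^ Suc n - (a 0 + (\<Sum>k=1..n. (a k - a (k - 1)) * norm w ^ k))"
    using sum_mono_coeff_telescope[of "norm w" a n] by linarith
  also have "\<dots> \<le> norm (of_real (a n) * w ^ Suc n) - norm ?d"
    using d an by (simp add: norm_mult norm_power)
  also have "\<dots> \<le> norm (of_real (a n) * w ^ Suc n - ?d)"
    by (rule norm_triangle_ineq2)
  also have "of_real (a n) * w ^ Suc n - ?d = (w - 1) * (\<Sum>k=0..n. of_real (a k) * w ^ k)"
    using sum_mono_coeff_telescope[of w "\<lambda>k. of_real (a k)" n] by (simp add: algebra_simps)
  finally show ?thesis by (simp add: norm_mult)
qed

text \<open>
  If \<open>R = \<bar>z\<bar>/p\<close> exceeds \<open>4/3\<close>, then \<open>(R-1)/(R+1) > 1/7\<close>, while \<open>\<bar>z\<bar> > 8/3\<close> makes the truncated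
  exponential at \<open>\<bar>z\<bar>\<close> at least \<open>1 + 8/3 + (8/3)\<^sup>2/2 > 7\<close>; so its modulus at \<open>z\<close> exceeds \<open>1\<close>.
\<close>

lemma stab_region_subset_cball:
  assumes "2 \<le> p" "z \<in> stab_region p"
  shows "cmod z \<le> 4 / 3 * real p"
proof (rule ccontr)
  assume "\<not> ?thesis"
  then have big: "4 / 3 * real p < cmod z" by simp
  define w where "w = z / of_nat p"
  define R where "R = cmod z / real p"
  define a :: "nat \<Rightarrow> real" where "a k = real p ^ k / fact k" for k
  have p0: "real p > 0" using assms by simp
  have nw: "norm w = R" by (simp add: w_def R_def norm_divide)
  have R: "4 / 3 < R" using big p0 by (simp add: R_def field_simps)
  have z: "cmod z > 8 / 3" using big assms(1) by simp
  have inc: "a k \<le> a (Suc k)" if "k < p" for k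
  proof -
    have "a (Suc k) = a k * (real p / real (Suc k))" by (simp add: a_def field_simps)
    moreover have "1 \<le> real p / real (Suc k)" using that by (simp add: field_simps)
    moreover have "0 \<le> a k" by (simp add: a_def)
    ultimately show ?thesis by (metis mult.right_neutral mult_left_mono)
  qed
  have Tz: "(\<Sum>k=0..p. of_real (a k) * w ^ k) = (\<Sum>k=0..p. z ^ k / fact k)"
    using p0 by (intro sum.cong) (simp_all add: a_def w_def power_divide)
  have Tabs: "(\<Sum>k=0..p. a k * norm w ^ k) = (\<Sum>k=0..p. cmod z ^ k / fact k)"
    using p0 by (intro sum.cong) (simp_all add: a_def nw R_def power_divide)
  have "(\<Sum>k=0..p. cmod z ^ k / fact k) \<ge> (\<Sum>k=0..2. cmod z ^ k / fact k)"
    using assms(1) by (intro sum_mono2) auto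
  moreover have "(\<Sum>k=0..2. cmod z ^ k / fact k) = 1 + cmod z + (cmod z)\<^sup>2 / 2"
    by (simp add: numeral_2_eq_2)
  moreover have "(cmod z)\<^sup>2 \<ge> (8 / 3)\<^sup>2" using z by (intro power_mono) auto
  ultimately have T7: "(\<Sum>k=0..p. cmod z ^ k / fact k) > 7"
    using z by (simp add: power2_eq_square)
  have "(R - 1) * 7 < (R - 1) * (\<Sum>k=0..p. cmod z ^ k / fact k)"
    using R T7 by (intro mult_strict_left_mono) auto
  also have "\<dots> \<le> norm (w - 1) * norm (\<Sum>k=0..p. z ^ k / fact k)"
    using norm_poly_mono_coeff_ge[of a p w, OF _ inc] unfolding Tz Tabs
    by (simp add: nw a_def)
  also have "\<dots> \<le> (R + 1) * 1"
    using assms(2) norm_triangle_ineq4[of w 1] R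
    by (intro mult_mono) (auto simp: stab_region_def nw)
  finally show False using R by simp
qed

section \<open>Assembling the bound\<close>

text \<open>
  After multiplication by \<open>(2r)!\<close>, the left side is the term of index \<open>r + m\<close> of the expansion
  of \<open>(3 + 1/3)\<^bsup>2r\<^esup>\<close>.
\<close>

lemma binomial_times_9_power_le:
  assumes "m \<le> r"
  shows "9 ^ m / (fact (r - m) * fact (r + m)) \<le> (10 / 3 :: real) ^ (2 * r) / fact (2 * r)"
proof -
  have "(10 / 3 :: real) ^ (2 * r) = (3 + 1 / 3) ^ (2 * r)" by simp
  also have "\<dots> = (\<Sum>k\<le>2 * r. real (2 * r choose k) * 3 ^ k * (1 / 3) ^ (2 * r - k))"
    by (rule binomial_ring)
  also have "\<dots> \<ge> real (2 * r choose (r + m)) * 3 ^ (r + m) * (1 / 3) ^ (2 * r - (r + m))"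
    using assms by (intro member_le_sum) auto
  also have "2 * r - (r + m) = r - m" by simp
  also have "real (2 * r choose (r + m)) = fact (2 * r) / (fact (r + m) * fact (r - m))"
    using assms by (simp add: binomial_fact)
  also have "(3::real) ^ (r + m) = 9 ^ m * 3 ^ (r - m)"
  proof -
    have "r + m = 2 * m + (r - m)" using assms by simp
    then have "(3::real) ^ (r + m) = 3 ^ (2 * m) * 3 ^ (r - m)" by (metis power_add)
    then show ?thesis by (simp add: power_mult)
  qed
  finally have "fact (2 * r) / (fact (r + m) * fact (r - m)) * (9 ^ m * 3 ^ (r - m)) * (1 / 3) ^ (r - m)
      \<le> (10 / 3 :: real) ^ (2 * r)" .
  then show ?thesis by (simp add: power_one_over field_simps)
qed

text \<open>
  With \<open>\<bar>z\<bar> \<le> 8r/3\<close>, the number \<open>a = 3r/m\<close> dominates the Fibonacci recurrence: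
  \<open>1 + \<bar>z/m\<bar> a \<le> 1 + 8 (r/m)\<^sup>2 \<le> a\<^sup>2\<close> because \<open>m \<le> r\<close>.  The exponent of \<open>a\<close> is at most \<open>2m - 1\<close>, so the
  powers of \<open>m\<close> in the weight absorb its denominator, and replacing the remaining ones by powers of \<open>r\<close>
  leads to the binomial term.
\<close>

lemma cmod_em_Q_le:
  assumes p: "2 \<le> p" "even p" and m: "m \<in> {1..p div 2}" and l: "l \<in> {1..2 * m}"
    and z: "z \<in> stab_region p"
  shows "cmod (poly (em_Q p m l) z) \<le> 2 / 3 * (5 / 3) ^ p * (real p ^ p / fact p)"
proof -
  define r where "r = p div 2"
  have pr: "p = 2 * r" using p by (simp add: r_def)
  have m1: "1 \<le> m" "m \<le> r" and l1: "1 \<le> l" using m l by (auto simp: r_def)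
  define a where "a = 3 * real r / real m"
  have mr: "real m > 0" "real m \<le> real r" using m1 by auto
  have a3: "a \<ge> 3" using mr by (simp add: a_def field_simps)
  have x: "norm (z / of_nat m) \<le> 8 / 3 * (real r / real m)"
    using stab_region_subset_cball[OF p(1) z] mr
    by (simp add: norm_divide pr field_simps)
  have "1 + norm (z / of_nat m) * a \<le> 1 + 8 / 3 * (real r / real m) * a"
    using x a3 by (intro add_left_mono mult_right_mono) auto
  also have "\<dots> = 1 + 8 * (real r / real m)\<^sup>2"
    by (simp add: a_def power2_eq_square)
  also have "\<dots> \<le> 9 * (real r / real m)\<^sup>2"
    using mr one_le_power[of "real r / real m" 2] by simp
  also have "\<dots> = a\<^sup>2" by (simp add: a_def power2_eq_square)
  finally have "norm (midpoint_response (z / of_nat m) (2 * m - l)) \<le> a ^ (2 * m - l)"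
    using a3 by (intro norm_midpoint_response_le) auto
  also have "\<dots> \<le> a ^ (2 * m - 1)"
    using a3 l1 by (intro power_increasing) auto
  finally have resp: "norm (midpoint_response (z / of_nat m) (2 * m - l)) \<le> a ^ (2 * m - 1)" .
  have "real m ^ (2 * r) * a ^ (2 * m - 1) = real m ^ (2 * r - (2 * m - 1)) * (3 * real r) ^ (2 * m - 1)"
  proof -
    have "real m ^ (2 * r) = real m ^ (2 * r - (2 * m - 1)) * real m ^ (2 * m - 1)"
      using m1 by (simp flip: power_add)
    then show ?thesis using mr by (simp add: a_def power_divide)
  qed
  also have "\<dots> \<le> real r ^ (2 * r - (2 * m - 1)) * (3 * real r) ^ (2 * m - 1)"
    using mr by (intro mult_right_mono power_mono) auto
  also have "\<dots> = 3 ^ (2 * m - 1) * real r ^ (2 * r)"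
    using m1 by (simp add: power_mult_distrib flip: power_add)
  also have "(3::real) ^ (2 * m - 1) = 9 ^ m / 3"
  proof -
    have "(3::real) ^ (2 * m) = 3 * 3 ^ (2 * m - 1)"
      using m1 by (subst power_Suc[symmetric]) simp
    then show ?thesis by (simp add: power_mult)
  qed
  finally have key: "real m ^ (2 * r) * a ^ (2 * m - 1) \<le> 9 ^ m / 3 * real r ^ (2 * r)" .
  have "cmod (poly (em_Q p m l) z) = 2 * real m ^ (2 * r) / (fact (r - m) * fact (r + m)) *
      norm (midpoint_response (z / of_nat m) (2 * m - l))"
    using poly_em_Q[OF m l] cmod_extrap_weight[OF m1] by (simp add: norm_mult r_def)
  also have "\<dots> \<le> 2 * real m ^ (2 * r) / (fact (r - m) * fact (r + m)) * a ^ (2 * m - 1)"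
    using resp by (intro mult_left_mono) auto
  also have "\<dots> = 2 / (fact (r - m) * fact (r + m)) * (real m ^ (2 * r) * a ^ (2 * m - 1))"
    by simp
  also have "\<dots> \<le> 2 / (fact (r - m) * fact (r + m)) * (9 ^ m / 3 * real r ^ (2 * r))"
    using key by (intro mult_left_mono) auto
  also have "\<dots> = 2 / 3 * real r ^ (2 * r) * (9 ^ m / (fact (r - m) * fact (r + m)))"
    by (simp add: ac_simps)
  also have "\<dots> \<le> 2 / 3 * real r ^ (2 * r) * ((10 / 3) ^ (2 * r) / fact (2 * r))"
    using binomial_times_9_power_le[OF m1(2)] by (intro mult_left_mono) auto
  also have "\<dots> = 2 / 3 * (5 / 3) ^ p * (real p ^ p / fact p)"
  proof -
    have "real r * (10 / 3) = 5 / 3 * real p" by (simp add: pr)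
    then have "real r ^ (2 * r) * (10 / 3) ^ (2 * r) = (5 / 3) ^ p * real p ^ p"
      by (metis pr power_mult_distrib)
    then show ?thesis by (simp add: pr)
  qed
  finally show ?thesis .
qed

lemma em_M_le:
  assumes "2 \<le> p"
    and "\<And>m l z. m \<in> {1..p div 2} \<Longrightarrow> l \<in> {1..2 * m} \<Longrightarrow> z \<in> S \<Longrightarrow> cmod (poly (em_Q p m l) z) \<le> B"
  shows "em_M p S \<le> ereal B"
  unfolding em_M_def
proof (intro Max.boundedI)
  show "(\<lambda>m. MAX l\<in>{1..2 * m}. SUP z\<in>S. ereal (cmod (poly (em_Q p m l) z))) ` {1..p div 2} \<noteq> {}"
    using assms(1) by auto
  fix x
  assume "x \<in> (\<lambda>m. MAX l\<in>{1..2 * m}. SUP z\<in>S. ereal (cmod (poly (em_Q p m l) z))) ` {1..p div 2}"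
  then obtain m where m: "m \<in> {1..p div 2}"
    and x: "x = (MAX l\<in>{1..2 * m}. SUP z\<in>S. ereal (cmod (poly (em_Q p m l) z)))" by blast
  show "x \<le> ereal B"
    unfolding x using m assms(2) by (intro Max.boundedI) (auto intro!: SUP_least)
qed simp

text \<open>
  The terms of index \<open>p - 1\<close> and \<open>p\<close> in the series of \<open>exp p\<close> are equal, which gains the factor \<open>2\<close> over
  the usual estimate from one term.
\<close>

lemma power_self_over_fact_le:
  assumes "1 \<le> p"
  shows "real p ^ p / fact p \<le> exp 1 ^ p / 2"
proof -
  have "(\<Sum>k\<in>{p - 1, p}. real p ^ k / fact k) \<le> (\<Sum>k. real p ^ k / fact k)"
    using exp_converges[of "real p"]
    by (intro sum_le_suminf) (auto simp: sums_iff divide_inverse mult.commute)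
  also have "\<dots> = exp (real p)"
    using exp_converges[of "real p"] by (simp add: sums_iff divide_inverse mult.commute)
  also have "real p ^ (p - 1) / fact (p - 1) = real p ^ p / fact p"
    using assms by (cases p) (simp_all del: of_nat_Suc)
  then have "(\<Sum>k\<in>{p - 1, p}. real p ^ k / fact k) = 2 * (real p ^ p / fact p)"
    using assms by simp
  finally show ?thesis using exp_of_nat_mult[of p "1::real"] by (simp add: mult.commute)
qed

text \<open>
  By \<open>e < 2.72\<close> the left side is at most \<open>q\<^sup>p/3\<close> with \<open>q = 13.6/3\<close>, and \<open>c\<close> is chosen with
  \<open>q (1 + c) \<le> 4.74\<close>.  Bernoulli's inequality \<open>(1 + c)\<^sup>p \<ge> 1 + c p\<close> suffices to absorb \<open>\<surd>p\<close>, because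
  \<open>1 + c p \<ge> 2 \<surd>(c p)\<close> by the inequality of arithmetic and geometric means.
\<close>

lemma em_bound_474:
  assumes "1 \<le> p"
  shows "2 / 3 * (5 / 3) ^ p * (real p ^ p / fact p) < sqrt (2 / pi) * (4.74 ^ p / sqrt (real p))"
proof -
  define q c :: real where "q = 13.6 / 3" and "c = 0.0455"
  have "2 / 3 * (5 / 3) ^ p * (real p ^ p / fact p) \<le> 2 / 3 * (5 / 3) ^ p * (exp 1 ^ p / 2)"
    using power_self_over_fact_le[OF assms] by (intro mult_left_mono) auto
  also have "\<dots> = (5 / 3 * exp 1) ^ p / 3" by (simp only: power_mult_distrib)
  also have "\<dots> \<le> q ^ p / 3"
    using e_less_272 by (intro divide_right_mono power_mono) (auto simp: q_def)
  also have "\<dots> < sqrt (2 / pi) * (q ^ p * (1 + c * real p) / sqrt (real p))"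
  proof -
    have "real p * pi < real p * (8 * 9 * c)"
      using assms pi_approx by (intro mult_strict_left_mono) (auto simp: c_def)
    also have "\<dots> \<le> 2 * 9 * (1 + c * real p)\<^sup>2"
      using zero_le_power2[of "1 - c * real p"] by (simp add: power2_eq_square algebra_simps)
    finally have "real p / 9 < 2 / pi * (1 + c * real p)\<^sup>2"
      by (simp add: field_simps)
    then have "sqrt (real p / 9) < sqrt (2 / pi * (1 + c * real p)\<^sup>2)"
      by simp
    then have "sqrt (real p) / 3 < sqrt (2 / pi) * (1 + c * real p)"
      by (simp add: real_sqrt_mult real_sqrt_divide c_def)
    then have "1 / 3 < sqrt (2 / pi) * ((1 + c * real p) / sqrt (real p))"
      using assms by (simp add: field_simps)
    then have "q ^ p * (1 / 3) < q ^ p * (sqrt (2 / pi) * ((1 + c * real p) / sqrt (real p)))"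
      by (intro mult_strict_left_mono) (auto simp: q_def)
    then show ?thesis by (simp add: mult.left_commute)
  qed
  also have "\<dots> \<le> sqrt (2 / pi) * (4.74 ^ p / sqrt (real p))"
  proof -
    have "1 + c * real p \<le> (1 + c) ^ p"
      using Bernoulli_inequality[of c p] by (simp add: c_def mult.commute)
    then have "q ^ p * (1 + c * real p) \<le> (q * (1 + c)) ^ p"
      unfolding power_mult_distrib by (intro mult_left_mono) (auto simp: q_def)
    also have "\<dots> \<le> 4.74 ^ p" by (intro power_mono) (auto simp: q_def c_def)
    finally show ?thesis by (intro mult_left_mono divide_right_mono) auto
  qed
  finally show ?thesis .
qed

text \<open>
  Squaring turns the claim into \<open>2 \<pi> (p-1) < d\<^sup>p p\<close> with \<open>d = (4.986/4.74)\<^sup>2\<close>.  From \<open>p = 19\<close> on, already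
  \<open>d\<^sup>p > 2 \<pi>\<close>; for \<open>p = 18\<close> this fails narrowly and the factor \<open>(p-1)/p\<close> decides.
\<close>

lemma bound_474_less_bound_4986:
  assumes "18 \<le> p"
  shows "sqrt (2 / pi) * (4.74 ^ p / sqrt (real p)) < 4.986 ^ p / (pi * sqrt (real p - 1))"
proof -
  define d :: real where "d = (4.986 / 4.74)\<^sup>2"
  have d: "2 * pi * (real p - 1) < d ^ p * real p"
  proof (cases "p = 18")
    case True
    have "2 * pi * 17 < 108" using pi_approx by simp
    also have "(108::real) < d ^ 18 * 18" by (simp add: d_def power_divide)
    finally show ?thesis using True by simp
  next
    case False
    have "2 * pi < 6.4" using pi_approx by simp
    also have "(6.4::real) < d ^ 19" by (simp add: d_def power_divide)
    also have "\<dots> \<le> d ^ p"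
      using assms False by (intro power_increasing) (auto simp: d_def power_divide)
    finally have "2 * pi < d ^ p" .
    then have "2 * pi * (real p - 1) \<le> d ^ p * (real p - 1)"
      using assms by (intro mult_right_mono) auto
    also have "\<dots> < d ^ p * real p"
      by (intro mult_strict_left_mono) (auto simp: d_def)
    finally show ?thesis .
  qed
  have "(sqrt (2 / pi) * (4.74 ^ p / sqrt (real p)))\<^sup>2 = 2 / pi * ((4.74 ^ p)\<^sup>2 / real p)"
    by (simp add: power_mult_distrib power_divide)
  also have "\<dots> < (4.74 ^ p)\<^sup>2 * (d ^ p / (pi\<^sup>2 * (real p - 1)))"
  proof -
    have "2 / pi / real p < d ^ p / (pi\<^sup>2 * (real p - 1))"
    proof -
      have "2 / pi / real p = 2 * pi * (real p - 1) / (pi\<^sup>2 * (real p * (real p - 1)))"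
        using assms by (simp add: field_simps power2_eq_square)
      also have "\<dots> < d ^ p * real p / (pi\<^sup>2 * (real p * (real p - 1)))"
        using d assms by (intro divide_strict_right_mono) auto
      also have "\<dots> = d ^ p / (pi\<^sup>2 * (real p - 1))"
        using assms by simp
      finally show ?thesis .
    qed
    then have "(4.74 ^ p)\<^sup>2 * (2 / pi / real p) < (4.74 ^ p)\<^sup>2 * (d ^ p / (pi\<^sup>2 * (real p - 1)))"
      by (intro mult_strict_left_mono) auto
    then show ?thesis by (simp add: mult.commute)
  qed
  also have "\<dots> = (4.986 ^ p / (pi * sqrt (real p - 1)))\<^sup>2"
  proof -
    have "(4.74 ^ p)\<^sup>2 * d ^ p = ((4.74 * (4.986 / 4.74)) ^ p)\<^sup>2"
      unfolding d_def power_mult_distrib by (simp add: mult.commute flip: power_mult)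
    also have "4.74 * (4.986 / 4.74) = (4.986 :: real)" by simp
    finally show ?thesis
      using assms by (simp add: power_mult_distrib power_divide)
  qed
  finally show ?thesis
    by (rule power2_less_imp_less) (use assms in simp)
qed

theorem theorem4p21:
  fixes p r :: nat
  assumes "2 \<le> p" and "even p" and "r = p div 2"
  shows "(1 \<le> r \<and> r \<le> 8 \<longrightarrow>
            em_M p (stab_region p) < ereal (sqrt (2 / pi) * (4.74 ^ p / sqrt (real p)))) \<and>
         (9 \<le> r \<longrightarrow>
            em_M p (stab_region p) < ereal (4.986 ^ p / (pi * sqrt (real p - 1))))"
proof -
  have "em_M p (stab_region p) \<le> ereal (2 / 3 * (5 / 3) ^ p * (real p ^ p / fact p))"
    using assms by (intro em_M_le cmod_em_Q_le)
  also have "\<dots> < ereal (sqrt (2 / pi) * (4.74 ^ p / sqrt (real p)))"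
    using em_bound_474[of p] assms(1) by simp
  finally have small: "em_M p (stab_region p) < \<dots>" .
  moreover have "em_M p (stab_region p) < ereal (4.986 ^ p / (pi * sqrt (real p - 1)))" if "9 \<le> r"
  proof -
    have "18 \<le> p" using that assms by simp
    then show ?thesis
      using small bound_474_less_bound_4986[of p] by (simp add: less_trans[OF small])
  qed
  ultimately show ?thesis by blast
qed

end
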